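(* The two-dimensional subalgebras of ${\rm S}_1$ are exactly $\langle e_1,e_2\rangle$, $\langle e_2,e_3\rangle$ and $\langle e_1,\alpha e_2+e_3\rangle$ ($\alpha\in\mathbb{C}$). Up to automorphisms of ${\rm S}_1$, every two-dimensional subalgebra is equivalent to $\langle e_1,e_2\rangle$ or $\langle e_2,e_3\rangle$.
   Context: ${\rm S}_1$ is the complex algebra with basis $e_1,e_2,e_3$ whose only nonzero products of basis elements are $e_1e_i=e_ie_1=e_i$ ($i=1,2,3$). A subalgebra is a linear subspace closed under multiplication (it need not contain $e_1$). Equivalence up to automorphisms means one is mapped onto the other by an algebra automorphism. $\langle S\rangle$ denotes linear span. *)

theory Defs
  imports "HOL-Analysis.Analysis"
begin

text \<open>The algebra S_1: complex^3 with basis e1 e2 e3 (the standard axis vectors),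
  products e1 ei = ei e1 = ei, all other products of basis vectors zero (bilinear extension).\<close>

definition e1 :: "complex^3" where "e1 = axis 1 1"
definition e2 :: "complex^3" where "e2 = axis 2 1"
definition e3 :: "complex^3" where "e3 = axis 3 1"

definition S1_mult :: "complex^3 \<Rightarrow> complex^3 \<Rightarrow> complex^3" where
  "S1_mult x y = (\<chi> i. if i = 1 then x$1 * y$1 else x$1 * y$i + x$i * y$1)"

definition S1_subalgebra :: "(complex^3) set \<Rightarrow> bool" where
  "S1_subalgebra V \<longleftrightarrow> vec.subspace V \<and> (\<forall>x\<in>V. \<forall>y\<in>V. S1_mult x y \<in> V)"

definition S1_automorphism :: "(complex^3 \<Rightarrow> complex^3) \<Rightarrow> bool" where
  "S1_automorphism f \<longleftrightarrow> Vector_Spaces.linear (*s) (*s) f \<and> bij f \<and>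
     (\<forall>x y. f (S1_mult x y) = S1_mult (f x) (f y))"

end

theory Submission
  imports Defs
begin

text \<open>Writing \<open>N = {x. x$1 = 0} = \<langle>e2, e3\<rangle>\<close>, every element of \<open>S1\<close> is \<open>c e1 + n\<close> with \<open>n \<in> N\<close>,
  and the product is \<open>x y = x$1 y + y$1 x - x$1 y$1 e1\<close>; in particular \<open>N N = 0\<close>. Hence every
  subspace that contains \<open>e1\<close> or lies in \<open>N\<close> is a subalgebra. Conversely, if a subalgebra contains
  \<open>x = c e1 + n\<close> with \<open>c \<noteq> 0\<close>, then \<open>x\<^sup>2 - c x = c n\<close> lies in it, hence so does \<open>e1\<close>. A
  two-dimensional subalgebra is therefore either \<open>N\<close> itself or \<open>\<langle>e1, n\<rangle>\<close> for a nonzero \<open>n \<in> N\<close>, and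
  rescaling \<open>n\<close> gives \<open>e2\<close> or \<open>\<alpha> e2 + e3\<close>. The linear map \<open>e1 \<mapsto> e1, e2 \<mapsto> e3, e3 \<mapsto> e2 - \<alpha> e3\<close>
  fixes \<open>e1\<close> and preserves \<open>N\<close>, so it is an automorphism, and it sends \<open>\<alpha> e2 + e3\<close> to \<open>e2\<close>.\<close>

lemma vec3_eq_iff: "(x::complex^3) = y \<longleftrightarrow> x$1 = y$1 \<and> x$2 = y$2 \<and> x$3 = y$3"
  by (simp add: vec_eq_iff forall_3)

lemma basis_components [simp]:
  "e1$1 = 1" "e1$2 = 0" "e1$3 = 0"
  "e2$1 = 0" "e2$2 = 1" "e2$3 = 0"
  "e3$1 = 0" "e3$2 = 0" "e3$3 = 1"
  by (simp_all add: e1_def e2_def e3_def axis_def)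

lemma S1_mult_components [simp]:
  "S1_mult x y $ 1 = x$1 * y$1"
  "S1_mult x y $ 2 = x$1 * y$2 + x$2 * y$1"
  "S1_mult x y $ 3 = x$1 * y$3 + x$3 * y$1"
  by (simp_all add: S1_mult_def)

lemma S1_mult_eq: "S1_mult x y = x$1 *s y + y$1 *s x - (x$1 * y$1) *s e1"
  by (simp add: vec3_eq_iff algebra_simps)

lemma span_e2_e3: "vec.span {e2, e3} = {x. x$1 = 0}"
proof (rule antisym)
  show "vec.span {e2, e3} \<subseteq> {x. x$1 = 0}"
    by (rule vec.span_minimal) (auto simp: vec.subspace_def)
  show "{x. x$1 = 0} \<subseteq> vec.span {e2, e3}"
  proof
    fix x :: "complex^3"
    assume "x \<in> {x. x$1 = 0}"
    have "x = x$2 *s e2 + x$3 *s e3"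
      using \<open>x \<in> {x. x$1 = 0}\<close> by (simp add: vec3_eq_iff)
    then show "x \<in> vec.span {e2, e3}"
      by (metis vec.span_add vec.span_base vec.span_scale insertI1 insertI2 singletonI)
  qed
qed

lemma S1_subalgebra_if_unit_mem:
  assumes "vec.subspace V" "e1 \<in> V"
  shows "S1_subalgebra V"
  unfolding S1_subalgebra_def S1_mult_eq
  using assms by (auto intro!: vec.subspace_diff vec.subspace_add vec.subspace_scale)

lemma S1_subalgebra_if_subset_radical:
  assumes "vec.subspace V" "V \<subseteq> {x. x$1 = 0}"
  shows "S1_subalgebra V"
proof -
  have "S1_mult x y = 0" if "x \<in> V" "y \<in> V" for x y
  proof -
    have "x$1 = 0" "y$1 = 0"
      using that assms(2) by auto
    then show ?thesis
      by (simp add: vec3_eq_iff)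
  qed
  then show ?thesis
    using assms(1) by (simp add: S1_subalgebra_def vec.subspace_0)
qed

lemma S1_subalgebra_unit_mem:
  assumes "S1_subalgebra V" "x \<in> V" "x$1 \<noteq> 0"
  shows "e1 \<in> V"
proof -
  define c where "c = x$1"
  have V: "vec.subspace V" "S1_mult x x \<in> V"
    using assms(1,2) by (auto simp: S1_subalgebra_def)
  have "e1 = (1/c) *s x - (1/c^2) *s (S1_mult x x - c *s x)"
    using assms(3) by (simp add: c_def vec3_eq_iff field_simps power2_eq_square)
  also have "\<dots> \<in> V"
    using V assms(2) by (intro vec.subspace_diff vec.subspace_scale) auto
  finally show ?thesis .
qed

lemma S1_subalgebra_iff:
  "S1_subalgebra V \<longleftrightarrow> vec.subspace V \<and> (e1 \<in> V \<or> V \<subseteq> {x. x$1 = 0})"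
  using S1_subalgebra_unit_mem S1_subalgebra_if_unit_mem S1_subalgebra_if_subset_radical
  by (auto simp: S1_subalgebra_def)

lemma dim_span_pair:
  assumes "a \<notin> vec.span {b}" "b \<noteq> 0"
  shows "vec.dim (vec.span {a, b}) = 2"
proof -
  have "a \<noteq> b"
    using assms(1) vec.span_base by blast
  moreover have "vec.independent {a, b}"
    using assms by (simp add: vec.independent_insert)
  ultimately show ?thesis
    using vec.dim_span_eq_card_independent by fastforce
qed

lemma dim_span_unit_radical:
  assumes "v$1 = 0" "v \<noteq> 0"
  shows "vec.dim (vec.span {e1, v}) = 2"
proof (rule dim_span_pair[OF _ assms(2)])
  show "e1 \<notin> vec.span {v}"
    using assms(1) by (auto simp: vec.span_singleton vec3_eq_iff)
qed

lemma dim_radical: "vec.dim {x::complex^3. x$1 = 0} = 2"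
proof -
  have "e2 \<notin> vec.span {e3}" "e3 \<noteq> 0"
    by (auto simp: vec.span_singleton vec3_eq_iff)
  then show ?thesis
    using dim_span_pair span_e2_e3 by metis
qed

lemma eq_span_unit_radical:
  assumes "vec.subspace V" "vec.dim V = 2" "e1 \<in> V" "v \<in> V" "v$1 = 0" "v \<noteq> 0"
  shows "V = vec.span {e1, v}"
proof (rule vec.subspace_dim_equal[OF vec.subspace_span assms(1), symmetric])
  show "vec.span {e1, v} \<subseteq> V"
    using assms by (intro vec.span_minimal) auto
  show "vec.dim V \<le> vec.dim (vec.span {e1, v})"
    using assms(2) dim_span_unit_radical[OF assms(5,6)] by simp
qed

lemma dim2_subspace_radical_elem:
  assumes "vec.subspace V" "vec.dim V = 2" "e1 \<in> V"
  obtains m where "m \<in> V" "m$1 = 0" "m \<noteq> 0"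
proof -
  have "\<not> V \<subseteq> vec.span {e1}"
    using vec.dim_le_card[of V "{e1}"] assms(2) by auto
  then obtain y where y: "y \<in> V" "y \<notin> vec.span {e1}"
    by auto
  define m where "m = y - y$1 *s e1"
  have "m \<in> V"
    unfolding m_def using assms(1,3) y(1) by (intro vec.subspace_diff vec.subspace_scale)
  moreover have "m \<noteq> 0"
    using y(2) by (auto simp: m_def vec.span_singleton)
  ultimately show ?thesis
    using that by (simp add: m_def)
qed

lemma dim2_S1_subalgebra_cases:
  assumes "S1_subalgebra V" "vec.dim V = 2"
  shows "V = vec.span {e1, e2} \<or> V = vec.span {e2, e3} \<or>
    (\<exists>\<alpha>. V = vec.span {e1, \<alpha> *s e2 + e3})"
proof -
  have V: "vec.subspace V"
    using assms(1) by (simp add: S1_subalgebra_def)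
  consider "V \<subseteq> {x. x$1 = 0}" | "e1 \<in> V"
    using assms(1) S1_subalgebra_iff by blast
  then show ?thesis
  proof cases
    case 1
    have "V = {x. x$1 = 0}"
      using vec.subspace_dim_equal[OF V _ 1] dim_radical assms(2) span_e2_e3
      by (metis order_refl vec.subspace_span)
    then show ?thesis
      by (simp add: span_e2_e3)
  next
    case 2
    obtain m where m: "m \<in> V" "m$1 = 0" "m \<noteq> 0"
      using dim2_subspace_radical_elem[OF V assms(2) 2] .
    have span_eq: "V = vec.span {e1, c *s m}" if "c \<noteq> 0" for c
      using eq_span_unit_radical[OF V assms(2) 2, of "c *s m"] that m V
      by (simp add: vec.subspace_scale)
    show ?thesis
    proof (cases "m$3 = 0")
      case True
      then have "m$2 \<noteq> 0"
        using m(2,3) by (auto simp: vec3_eq_iff)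
      then have "e2 = (1 / m$2) *s m"
        using True m(2) by (simp add: vec3_eq_iff)
      then show ?thesis
        using span_eq[of "1 / m$2"] \<open>m$2 \<noteq> 0\<close> by simp
    next
      case False
      then have "(m$2 / m$3) *s e2 + e3 = (1 / m$3) *s m"
        using m(2) by (simp add: vec3_eq_iff)
      then have "V = vec.span {e1, (m$2 / m$3) *s e2 + e3}"
        using span_eq[of "1 / m$3"] False by simp
      then show ?thesis
        by blast
    qed
  qed
qed

lemma dim2_S1_subalgebra_iff:
  "S1_subalgebra V \<and> vec.dim V = 2 \<longleftrightarrow>
    V = vec.span {e1, e2} \<or> V = vec.span {e2, e3} \<or>
    (\<exists>\<alpha>. V = vec.span {e1, \<alpha> *s e2 + e3})"
proof
  have unit_span: "S1_subalgebra (vec.span {e1, v}) \<and> vec.dim (vec.span {e1, v}) = 2"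
    if "v$1 = 0" "v \<noteq> 0" for v
    using that dim_span_unit_radical
    by (simp add: S1_subalgebra_if_unit_mem vec.span_base vec.subspace_span)
  have "S1_subalgebra (vec.span {e2, e3})"
    by (rule S1_subalgebra_if_subset_radical[OF vec.subspace_span]) (simp add: span_e2_e3)
  moreover have "vec.dim (vec.span {e2, e3}) = 2"
    by (simp add: span_e2_e3 dim_radical)
  moreover have "e2 \<noteq> 0" "\<alpha> *s e2 + e3 \<noteq> 0" for \<alpha>
    by (simp_all add: vec3_eq_iff)
  ultimately show "S1_subalgebra V \<and> vec.dim V = 2"
    if "V = vec.span {e1, e2} \<or> V = vec.span {e2, e3} \<or> (\<exists>\<alpha>. V = vec.span {e1, \<alpha> *s e2 + e3})"
    using that unit_span by auto
qed (use dim2_S1_subalgebra_cases in blast)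

definition straighten :: "complex \<Rightarrow> complex^3 \<Rightarrow> complex^3" where
  "straighten \<alpha> x = (\<chi> i. if i = 1 then x$1 else if i = 2 then x$3 else x$2 - \<alpha> * x$3)"

lemma straighten_components [simp]:
  "straighten \<alpha> x $ 1 = x$1" "straighten \<alpha> x $ 2 = x$3" "straighten \<alpha> x $ 3 = x$2 - \<alpha> * x$3"
  by (simp_all add: straighten_def)

lemma linear_straighten: "Vector_Spaces.linear (*s) (*s) (straighten \<alpha>)"
  unfolding Vector_Spaces.linear_iff
  by (simp add: vec.vector_space_axioms vec3_eq_iff algebra_simps)

lemma S1_automorphism_straighten: "S1_automorphism (straighten \<alpha>)"
  unfolding S1_automorphism_def
proof (intro conjI allI linear_straighten)
  let ?inv = "\<lambda>x. \<chi> i. if i = 1 then x$1 else if i = 2 then x$3 + \<alpha> * x$2 else x$2"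
  show "bij (straighten \<alpha>)"
    by (rule o_bij[of ?inv]) (simp_all add: fun_eq_iff vec3_eq_iff)
  show "straighten \<alpha> (S1_mult x y) = S1_mult (straighten \<alpha> x) (straighten \<alpha> y)" for x y
    by (simp add: vec3_eq_iff algebra_simps)
qed

lemma straighten_image:
  "straighten \<alpha> ` vec.span {e1, \<alpha> *s e2 + e3} = vec.span {e1, e2}"
proof -
  have "straighten \<alpha> e1 = e1" "straighten \<alpha> (\<alpha> *s e2 + e3) = e2"
    by (simp_all add: vec3_eq_iff)
  moreover have "vec.span (straighten \<alpha> ` {e1, \<alpha> *s e2 + e3}) = straighten \<alpha> ` vec.span {e1, \<alpha> *s e2 + e3}"
    by (rule vec.linear_span_image[OF linear_straighten])
  ultimately show ?thesis
    by simp
qed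

lemma S1_automorphism_id: "S1_automorphism id"
  by (simp add: S1_automorphism_def vec.linear_id)

theorem mainTheorem15:
  shows "(\<forall>V. (S1_subalgebra V \<and> vec.dim V = 2) \<longleftrightarrow>
            (V = vec.span {e1, e2} \<or> V = vec.span {e2, e3} \<or>
             (\<exists>\<alpha>::complex. V = vec.span {e1, \<alpha> *s e2 + e3})))
       \<and> (\<forall>V. S1_subalgebra V \<and> vec.dim V = 2 \<longrightarrow>
            (\<exists>f. S1_automorphism f \<and> (f ` V = vec.span {e1, e2} \<or> f ` V = vec.span {e2, e3})))"
proof (intro conjI allI impI dim2_S1_subalgebra_iff)
  fix V :: "(complex^3) set"
  assume "S1_subalgebra V \<and> vec.dim V = 2"
  then consider "V = vec.span {e1, e2} \<or> V = vec.span {e2, e3}"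
    | \<alpha> where "V = vec.span {e1, \<alpha> *s e2 + e3}"
    using dim2_S1_subalgebra_cases by blast
  then show "\<exists>f. S1_automorphism f \<and> (f ` V = vec.span {e1, e2} \<or> f ` V = vec.span {e2, e3})"
  proof cases
    case 1
    then show ?thesis
      using S1_automorphism_id by auto
  next
    case 2
    then show ?thesis
      using S1_automorphism_straighten straighten_image by blast
  qed
qed

end
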